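(* For every integer $n\ge 1$, the number of collapsed permutations in $S_{2n}$ equals the median Genocchi number $H_{2n-1}$.
   Context: A permutation $\pi\in S_N$ is collapsed if for every $k\in[N]$, $\pi^{-1}(k)\ge \lceil k/2\rceil$ when $N$ is odd (resp. $\pi^{-1}(k)\ge 1+\lfloor k/2\rfloor$ when $N$ is even), and $\pi^{-1}(k)\le \lceil N/2\rceil+\lfloor k/2\rfloor$. Seidel triangle: numbers $S_{N,k}$ ($N\ge1$, $k\in\mathbb{Z}$) with $S_{1,2}=1$ and $S_{1,k}=0$ for $k\ne 2$; for $N\ge 2$, $S_{N,k}=0$ if $k<2$ or $k>(N+3)/2$, and otherwise $S_{2m,k}=\sum_{i\ge k}S_{2m-1,i}$ and $S_{2m+1,k}=\sum_{i\le k}S_{2m,i}$. The median Genocchi numbers (Genocchi numbers of the second kind) are $H_{2n-1}=S_{2n,2}$ for $n\ge 1$, giving $H_1=1,H_3=2,H_5=8,H_7=56,H_9=608,\dots$. *)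

theory Defs
  imports Complex_Main "HOL-Combinatorics.Permutations"
begin

text \<open>The argument \<open>N\<close> is the size of the ground set \<open>{1..N}\<close>; the definition is meant for
  \<open>p permutes {1..N}\<close>.\<close>

definition collapsed :: "nat \<Rightarrow> (nat \<Rightarrow> nat) \<Rightarrow> bool" where
  "collapsed N p \<longleftrightarrow> (\<forall>k\<in>{1..N}.
     (if odd N then \<lceil>real k / 2\<rceil> \<le> int (inv p k)
      else 1 + \<lfloor>real k / 2\<rfloor> \<le> int (inv p k)) \<and>
     int (inv p k) \<le> \<lceil>real N / 2\<rceil> + \<lfloor>real k / 2\<rfloor>)"

text \<open>Seidel triangle \<open>S\<^sub>N\<^sub>,\<^sub>k\<close>, with \<open>N \<ge> 1\<close>; row \<open>0\<close> is a dummy.  The sums over \<open>i \<ge> k\<close> and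
  \<open>i \<le> k\<close> are restricted to \<open>2 \<le> i \<le> (N + 3) / 2\<close>, since row \<open>N\<close> vanishes
  elsewhere (lemma \<open>seidel_eq_0\<close>) and \<open>sum\<close> over an infinite set is \<open>0\<close>.\<close>

fun seidel :: "nat \<Rightarrow> int \<Rightarrow> nat" where
  "seidel 0 k = 0"
| "seidel (Suc 0) k = (if k = 2 then 1 else 0)"
| "seidel (Suc (Suc N)) k =
     (if k < 2 \<or> 2 * k > int (Suc (Suc N)) + 3 then 0
      else if even N then \<Sum>i\<in>{k..(int (Suc N) + 3) div 2}. seidel (Suc N) i
      else \<Sum>i\<in>{2..k}. seidel (Suc N) i)"

lemma seidel_eq_0: "k < 2 \<or> 2 * k > int N + 3 \<Longrightarrow> seidel N k = 0"
  by (cases "(N, k)" rule: seidel.cases) auto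

text \<open>The numbers \<open>H\<^sub>m\<close> for odd \<open>m\<close>, given by \<open>H\<^sub>2\<^sub>n\<^sub>-\<^sub>1 = S\<^sub>2\<^sub>n\<^sub>,\<^sub>2\<close>;
  the value at an even argument has no meaning.\<close>

definition median_genocchi :: "nat \<Rightarrow> nat" where
  "median_genocchi m = seidel (m + 1) 2"

end

theory Submission
  imports Defs
begin

text \<open>
  For \<open>N = 2 n\<close> a permutation is collapsed iff \<open>p u \<le> 2 u - 1 < p (n + u)\<close> for
  \<open>1 \<le> u \<le> n\<close>. Filling the places \<open>1, n + 1, 2, n + 2, \<dots>\<close> in this order, and counting a lower
  bound as the absence of a bound minus the complementary upper bound, the number of collapsed
  permutations becomes \<open>R\<^sub>n(0)\<close>, where \<open>R\<^sub>0 = 1\<close>, \<open>R\<^sub>n\<^sub>+\<^sub>1 = L R\<^sub>n\<close> and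
  \<open>L g (t) = (t + 1) ((t + 1) g (t + 1) - t g t)\<close>.

  On the other side, the Seidel recurrences determine every entry from the first column. Starting
  them with the functions \<open>R\<^sub>n(t)\<close> as first column, one obtains a triangle of functions of \<open>t\<close>; it is
  the Seidel triangle at \<open>t = 0\<close> as soon as the entry just behind the end of each even row
  vanishes there. Since \<open>L\<close> is linear it shifts the rows, and
  \<open>L (t g) = (t + 1) (L g + t g)\<close> shows that this entry is \<open>t\<close> times the last entry of
  the preceding odd row.
\<close>

section \<open>Filling places with bounds\<close>

definition fillings :: "('a \<Rightarrow> bool) list \<Rightarrow> 'a set \<Rightarrow> 'a list set" where
  "fillings Ps B = {xs. distinct xs \<and> set xs \<subseteq> B \<and> list_all2 (\<lambda>P x. P x) Ps xs}"

lemma fillings_Nil [simp]: "fillings [] B = {[]}"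
  by (auto simp: fillings_def)

lemma fillings_Cons:
  "fillings (P # Ps) B = (\<Union>x\<in>{x\<in>B. P x}. (#) x ` fillings Ps (B - {x}))"
  by (auto simp: fillings_def list_all2_Cons1 image_iff)

lemma finite_fillings [simp]: "finite B \<Longrightarrow> finite (fillings Ps B)"
  by (induction Ps arbitrary: B) (auto simp: fillings_Cons)

lemma card_fillings_Cons:
  assumes "finite B"
  shows "card (fillings (P # Ps) B) = (\<Sum>x\<in>{x\<in>B. P x}. card (fillings Ps (B - {x})))"
  unfolding fillings_Cons using assms
  by (subst card_UN_disjoint) (auto simp: card_image)

text \<open>A place without a condition can be filled last, by any element that the other places
  leave over.\<close>

lemma card_fillings_Cons_True:
  assumes "finite B"
  shows "card (fillings ((\<lambda>_. True) # Ps) B) = card (fillings Ps B) * (card B - length Ps)"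
proof -
  have "fillings ((\<lambda>_. True) # Ps) B = (\<lambda>(xs, x). x # xs) ` (SIGMA xs:fillings Ps B. B - set xs)"
    by (auto simp: fillings_def list_all2_Cons1 image_iff)
  moreover have "inj_on (\<lambda>(xs, x). x # xs) (SIGMA xs:fillings Ps B. B - set xs)"
    by (auto simp: inj_on_def)
  ultimately have "card (fillings ((\<lambda>_. True) # Ps) B)
      = card (SIGMA xs:fillings Ps B. B - set xs)"
    by (simp add: card_image)
  also have "\<dots> = (\<Sum>xs\<in>fillings Ps B. card (B - set xs))"
    using assms by (subst card_SigmaI) auto
  also have "\<dots> = (\<Sum>xs\<in>fillings Ps B. card B - length Ps)"
    by (rule sum.cong)
      (auto simp: fillings_def card_Diff_subset distinct_card dest: list_all2_lengthD)
  finally show ?thesis by simp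
qed

lemma card_fillings_Cons_compl:
  assumes "finite B"
  shows "card (fillings ((\<lambda>_. True) # Ps) B)
    = card (fillings (P # Ps) B) + card (fillings ((\<lambda>x. \<not> P x) # Ps) B)"
proof -
  have "fillings ((\<lambda>_. True) # Ps) B = fillings (P # Ps) B \<union> fillings ((\<lambda>x. \<not> P x) # Ps) B"
    by (auto simp: fillings_def list_all2_Cons1)
  moreover have "fillings (P # Ps) B \<inter> fillings ((\<lambda>x. \<not> P x) # Ps) B = {}"
    by (auto simp: fillings_def list_all2_Cons1)
  ultimately show ?thesis
    using assms by (simp add: card_Un_disjoint)
qed

text \<open>Here \<open>t\<close> is the number of elements left over once \<open>n\<close> pairs of
  places are filled. The first factor counts the choices under an upper bound; the bracket takes the
  free fillings of the partner place minus those under the same bound.\<close>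

fun R :: "nat \<Rightarrow> nat \<Rightarrow> int" where
  "R 0 t = 1"
| "R (Suc n) t = (int t + 1) * ((int t + 1) * R n (Suc t) - int t * R n t)"

fun bounds :: "'a::linorder list \<Rightarrow> ('a \<Rightarrow> bool) list" where
  "bounds [] = []"
| "bounds (c # cs) = (\<lambda>x. x \<le> c) # (\<lambda>x. \<not> x \<le> c) # bounds cs"

lemma length_bounds [simp]: "length (bounds cs) = 2 * length cs"
  by (induction cs) auto

text \<open>Only the number of elements under each threshold matters: thresholds increase, so an
  element taken under the first lies under all later ones.\<close>

lemma card_fillings_bounds:
  fixes cs :: "'a::linorder list"
  assumes "finite B" "sorted cs" "card B = 2 * length cs + t"
    "\<And>u. u < length cs \<Longrightarrow> card {x\<in>B. x \<le> cs ! u} = t + 2 * u + 1"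
  shows "int (card (fillings (bounds cs) B)) = R (length cs) t"
  using assms
proof (induction cs arbitrary: B t)
  case Nil
  then show ?case by simp
next
  case (Cons c cs)
  let ?n = "length cs"
  have le: "c \<le> cs ! u" if "u < ?n" for u
    using Cons.prems(2) that by auto
  have small: "card {x\<in>B. x \<le> c} = t + 1"
    using Cons.prems(4)[of 0] by simp
  have rest: "card {x\<in>B. x \<le> cs ! u} = t + 2 * u + 3" if "u < ?n" for u
    using Cons.prems(4)[of "Suc u"] that by simp
  have step: "int (card (fillings ((\<lambda>x. \<not> x \<le> c) # bounds cs) (B - {y})))
      = (int t + 1) * R ?n (Suc t) - int t * R ?n t"
    if y: "y \<in> B" "y \<le> c" for y
  proof -
    let ?B = "B - {y}"
    have fin: "finite ?B" and card: "card ?B = 2 * ?n + Suc t"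
      using Cons.prems y by auto
    have "{x\<in>?B. x \<le> cs ! u} = {x\<in>B. x \<le> cs ! u} - {y}" for u
      by auto
    then have card_le: "card {x\<in>?B. x \<le> cs ! u} = t + 2 * u + 2" if "u < ?n" for u
      using y le[OF that] rest[OF that] by auto
    \<comment> \<open>Without \<open>y\<close>, \<open>t + 2 * u + 2 = Suc t + 2 * u + 1\<close>
      elements remain under a later threshold, so the parameter is \<open>Suc t\<close>; removing a
      further \<open>z\<close> under \<open>c\<close> brings it back to \<open>t\<close>.\<close>
    have "int (card (fillings (bounds cs) ?B)) = R ?n (Suc t)"
      using Cons.prems(2) card_le by (intro Cons.IH[OF fin _ card]) simp_all
    then have free: "int (card (fillings ((\<lambda>_. True) # bounds cs) ?B))
        = (int t + 1) * R ?n (Suc t)"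
      by (simp add: card_fillings_Cons_True[OF fin] card algebra_simps)
    have upper: "int (card (fillings (bounds cs) (?B - {z}))) = R ?n t"
      if z: "z \<in> ?B" "z \<le> c" for z
    proof (rule Cons.IH)
      fix u assume u: "u < ?n"
      have "{x\<in>?B - {z}. x \<le> cs ! u} = {x\<in>?B. x \<le> cs ! u} - {z}"
        by auto
      then show "card {x\<in>?B - {z}. x \<le> cs ! u} = t + 2 * u + 1"
        using z le[OF u] card_le[OF u] by auto
    qed (use fin card z Cons.prems(2) in auto)
    have "{x\<in>?B. x \<le> c} = {x\<in>B. x \<le> c} - {y}"
      by auto
    then have "card {x\<in>?B. x \<le> c} = t"
      using y small by auto
    moreover have "int (card (fillings ((\<lambda>x. x \<le> c) # bounds cs) ?B))
        = (\<Sum>z\<in>{x\<in>?B. x \<le> c}. R ?n t)"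
      unfolding card_fillings_Cons[OF fin] of_nat_sum by (rule sum.cong) (use upper in auto)
    ultimately show ?thesis
      using free card_fillings_Cons_compl[OF fin, of "bounds cs" "\<lambda>x. x \<le> c"] by simp
  qed
  have "int (card (fillings (bounds (c # cs)) B))
      = (\<Sum>y\<in>{x\<in>B. x \<le> c}. (int t + 1) * R ?n (Suc t) - int t * R ?n t)"
    unfolding bounds.simps card_fillings_Cons[OF Cons.prems(1), of _ "_ # _"] of_nat_sum
    by (rule sum.cong) (use step in auto)
  then show ?case
    using small by simp
qed

section \<open>Collapsed permutations\<close>

lemma bij_betw_permutes_lists:
  assumes "distinct ks" "set ks = A"
  shows "bij_betw (\<lambda>p. map p ks) {p. p permutes A}
    {xs. length xs = length ks \<and> distinct xs \<and> set xs \<subseteq> A}" (is "bij_betw ?f ?P ?X")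
proof -
  have fin: "finite A" and card: "card A = length ks"
    using assms by (auto simp: distinct_card)
  have inj: "inj_on ?f ?P"
  proof (rule inj_onI)
    fix p q assume "p \<in> ?P" "q \<in> ?P" "map p ks = map q ks"
    then show "p = q"
      using assms by (intro ext) (metis map_eq_conv mem_Collect_eq permutes_not_in)
  qed
  have sub: "?f ` ?P \<subseteq> ?X"
    using assms by (auto simp: distinct_map permutes_in_image intro: permutes_inj_on)
  \<comment> \<open>Surjectivity comes from counting: both sides have
    \<open>fact (length ks)\<close> elements.\<close>
  have "card ?X = fact (length ks)"
    using card_lists_distinct_length_eq[OF fin, of "length ks"] card
    by (simp add: fact_prod)
  then have "card (?f ` ?P) = card ?X"
    using inj card_permutations[OF card fin] by (simp add: card_image)
  moreover have "finite ?X"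
    using finite_lists_length_eq[OF fin, of "length ks"] by (rule rev_finite_subset) auto
  ultimately have "?f ` ?P = ?X"
    using sub card_subset_eq by blast
  with inj show ?thesis by (simp add: bij_betw_def)
qed

text \<open>Put \<open>k = p v\<close>. One of the two bounds is then automatic: the upper one for
  \<open>v \<le> n\<close>, the lower one for \<open>v > n\<close>, since
  \<open>p v \<le> 2 * n\<close>.\<close>

lemma collapsed_even_iff:
  assumes "p permutes {1..2 * n}"
  shows "collapsed (2 * n) p \<longleftrightarrow> (\<forall>u\<in>{1..n}. p u \<le> 2 * u - 1 \<and> 2 * u \<le> p (n + u))"
proof -
  have "collapsed (2 * n) p \<longleftrightarrow>
      (\<forall>k\<in>{1..2 * n}. 1 + k div 2 \<le> inv p k \<and> inv p k \<le> n + k div 2)"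
  proof -
    have "\<lfloor>real k / 2\<rfloor> = int (k div 2)" for k
      by (metis floor_divide_of_nat_eq of_nat_numeral)
    then show ?thesis
      unfolding collapsed_def by (intro ball_cong) auto
  qed
  also have "\<dots> \<longleftrightarrow> (\<forall>v\<in>{1..2 * n}. 1 + p v div 2 \<le> v \<and> v \<le> n + p v div 2)"
    by (subst permutes_image[OF assms, symmetric]) (simp add: permutes_inverses(2)[OF assms])
  also have "\<dots> \<longleftrightarrow> (\<forall>u\<in>{1..n}. p u \<le> 2 * u - 1 \<and> 2 * u \<le> p (n + u))"
  proof (intro iffI ballI)
    fix u assume *: "\<forall>v\<in>{1..2 * n}. 1 + p v div 2 \<le> v \<and> v \<le> n + p v div 2" and u: "u \<in> {1..n}"
    then have "1 + p u div 2 \<le> u" "n + u \<le> n + p (n + u) div 2"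
      by (metis atLeastAtMost_iff le_add2 mult_2 order_trans,
          metis add_le_cancel_left atLeastAtMost_iff mult_2 trans_le_add2)
    then show "p u \<le> 2 * u - 1 \<and> 2 * u \<le> p (n + u)" by linarith
  next
    fix v assume *: "\<forall>u\<in>{1..n}. p u \<le> 2 * u - 1 \<and> 2 * u \<le> p (n + u)" and v: "v \<in> {1..2 * n}"
    have "p v \<in> {1..2 * n}"
      using v permutes_in_image[OF assms] by blast
    show "1 + p v div 2 \<le> v \<and> v \<le> n + p v div 2"
    proof (cases "v \<le> n")
      case True
      then have "p v \<le> 2 * v - 1" using * v by auto
      then show ?thesis using True v by auto
    next
      case False
      then have "v - n \<in> {1..n}" "n + (v - n) = v"
        using v by auto
      then have "2 * (v - n) \<le> p v" using * by metis
      then show ?thesis using False v \<open>p v \<in> _\<close> by auto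
    qed
  qed
  finally show ?thesis .
qed

lemma list_all2_bounds_iff:
  "list_all2 (\<lambda>P x. P x) (bounds (map c us)) (map p (concat (map (\<lambda>u. [f u, g u]) us)))
    \<longleftrightarrow> (\<forall>u\<in>set us. p (f u) \<le> c u \<and> c u < p (g u))"
  by (induction us) auto

lemma card_collapsed_even:
  "int (card {p. p permutes {1..2 * n} \<and> collapsed (2 * n) p}) = R n 0"
proof -
  define us where "us = [1..<Suc n]"
  \<comment> \<open>The interleaving makes the two conditions with threshold
    \<open>2 * u - 1\<close> adjacent, as \<open>bounds\<close> expects.\<close>
  define ks where "ks = concat (map (\<lambda>u. [u, n + u]) us)"
  let ?c = "\<lambda>u. 2 * u - 1 :: nat"
  let ?A = "{1..2 * n}"
  let ?X = "{xs. length xs = length ks \<and> distinct xs \<and> set xs \<subseteq> ?A}"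
  let ?Q = "list_all2 (\<lambda>P x. P x) (bounds (map ?c us))"
  have set_us: "set us = {1..n}"
    by (simp add: us_def atLeastLessThanSuc_atLeastAtMost del: upt_Suc)
  have set_ks: "set ks = ?A"
  proof -
    have "set ks = {1..n} \<union> (+) n ` {1..n}"
      by (auto simp: ks_def set_us simp del: image_add_atLeastAtMost)
    then show ?thesis by auto
  qed
  have len: "length ks = 2 * n"
    unfolding ks_def by (simp add: length_concat comp_def us_def sum_list_triv)
  have dist: "distinct ks"
    using set_ks len by (simp add: card_distinct)
  have eq: "collapsed (2 * n) p \<longleftrightarrow> ?Q (map p ks)" if "p permutes ?A" for p
    unfolding ks_def list_all2_bounds_iff collapsed_even_iff[OF that]
    by (rule ball_cong) (auto simp: us_def)
  have "bij_betw (\<lambda>p. map p ks) {p \<in> {p. p permutes ?A}. collapsed (2 * n) p} {xs \<in> ?X. ?Q xs}"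
    using bij_betw_permutes_lists[OF dist set_ks]
    by (rule bij_betw_Collect) (simp add: eq)
  moreover have "{xs \<in> ?X. ?Q xs} = fillings (bounds (map ?c us)) ?A"
    by (auto simp: fillings_def us_def len dest: list_all2_lengthD)
  ultimately have "card {p. p permutes ?A \<and> collapsed (2 * n) p}
      = card (fillings (bounds (map ?c us)) ?A)"
    by (simp add: bij_betw_same_card)
  also have "int \<dots> = R (length (map ?c us)) 0"
  proof (rule card_fillings_bounds)
    show "sorted (map ?c us)"
      by (auto simp: us_def sorted_iff_nth_mono simp del: upt_Suc)
    fix u assume "u < length (map ?c us)"
    \<comment> \<open>Positions count from 0, so the threshold at \<open>u\<close> is
      \<open>2 * (u + 1) - 1\<close>.\<close>
    then have "{x \<in> ?A. x \<le> map ?c us ! u} = {1..2 * u + 1}"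
      by (auto simp: us_def simp del: upt_Suc)
    then show "card {x \<in> ?A. x \<le> map ?c us ! u} = 0 + 2 * u + 1"
      by simp
  qed (auto simp: us_def)
  finally show ?thesis
    by (simp add: us_def del: upt_Suc)
qed

section \<open>The Seidel triangle\<close>

text \<open>The entry \<open>tri i n t\<close> stands in row \<open>2 n\<close> at \<open>k = i + 2\<close>; the sum in its definition is the
  entry of row \<open>2 n + 1\<close>. Only \<open>i \<le> n\<close> is meaningful.\<close>

fun tri :: "nat \<Rightarrow> nat \<Rightarrow> nat \<Rightarrow> int" where
  "tri 0 n t = R n t"
| "tri (Suc i) 0 t = 0"
| "tri (Suc i) (Suc n) t = tri i (Suc n) t - (\<Sum>j\<le>i. tri j n t)"

definition L :: "(nat \<Rightarrow> int) \<Rightarrow> nat \<Rightarrow> int" where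
  "L g t = (int t + 1) * ((int t + 1) * g (Suc t) - int t * g t)"

lemma L_diff: "L (\<lambda>t. f t - g t) t = L f t - L g t"
  by (simp add: L_def algebra_simps)

lemma L_sum: "L (\<lambda>t. \<Sum>j\<in>A. f j t) t = (\<Sum>j\<in>A. L (f j) t)"
  by (simp add: L_def sum_distrib_left sum_subtractf right_diff_distrib)

lemma L_mult: "L (\<lambda>t. int t * g t) t = (int t + 1) * (L g t + int t * g t)"
  by (simp add: L_def algebra_simps)

text \<open>Column 0 is the recurrence of \<open>R\<close>; linearity carries it to the other
  columns. Outside \<open>i \<le> n\<close> it can fail: \<open>tri 1 0\<close> is zero, but
  \<open>tri 1 1 t = t\<close>.\<close>

lemma L_tri: "i \<le> n \<Longrightarrow> L (tri i n) t = tri i (Suc n) t"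
proof (induction i n t rule: tri.induct)
  case (1 n t)
  then show ?case by (simp add: L_def)
next
  case (3 i n t)
  have "L (tri (Suc i) (Suc n)) t = L (tri i (Suc n)) t - (\<Sum>j\<le>i. L (tri j n) t)"
  proof -
    have "tri (Suc i) (Suc n) = (\<lambda>t. tri i (Suc n) t - (\<Sum>j\<le>i. tri j n t))"
      by auto
    then show ?thesis by (simp only: L_diff L_sum)
  qed
  with 3 show ?case by (simp del: tri.simps(3)) simp
qed simp

lemma tri_diagonal: "tri (Suc n) (Suc n) t = int t * (\<Sum>j\<le>n. tri j n t)"
proof (induction n arbitrary: t)
  case 0
  then show ?case by (simp add: algebra_simps)
next
  case (Suc n)
  let ?f = "\<lambda>t. \<Sum>j\<le>n. tri j n t"
  have diag: "tri (Suc n) (Suc n) = (\<lambda>t. int t * ?f t)"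
    using Suc.IH by blast
  \<comment> \<open>All terms but the last are \<open>L\<close> of the terms of \<open>?f\<close>;
    the last is the induction hypothesis.\<close>
  have odd_row: "(\<Sum>j\<le>Suc n. tri j (Suc n) t) = L ?f t + int t * ?f t"
    using Suc.IH by (simp add: L_sum L_tri)
  have "tri (Suc (Suc n)) (Suc (Suc n)) t
      = L (tri (Suc n) (Suc n)) t - (\<Sum>j\<le>Suc n. tri j (Suc n) t)"
    by (simp only: tri.simps(3)[of "Suc n"] L_tri[OF order_refl])
  \<comment> \<open>By \<open>L_mult\<close> and \<open>odd_row\<close> the minuend is
    \<open>t + 1\<close> times the sum that is subtracted.\<close>
  also have "\<dots> = int t * (\<Sum>j\<le>Suc n. tri j (Suc n) t)"
    unfolding diag L_mult odd_row by (simp add: algebra_simps)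
  finally show ?case .
qed

text \<open>The differences telescope down from column \<open>Suc n\<close>, where
  \<open>tri_diagonal\<close> gives 0 at \<open>t = 0\<close>.\<close>

lemma tri_eq_sum:
  assumes "i \<le> Suc n"
  shows "tri i (Suc n) 0 = (\<Sum>l\<in>{i..<Suc n}. \<Sum>j\<le>l. tri j n 0)"
  using assms
proof (induction i rule: inc_induct)
  case base
  show ?case using tri_diagonal[of n 0] by simp
next
  case (step i)
  then show ?case by (simp add: sum.atLeast_Suc_lessThan del: sum.op_ivl_Suc)
qed

lemma sum_int_shift: "(\<Sum>l\<in>{int a + 2..int b + 1}. f l) = (\<Sum>l\<in>{a..<b}. f (int l + 2))"
  by (rule sum.reindex_bij_witness[of _ "\<lambda>l. int l + 2" "\<lambda>l. nat (l - 2)"]) auto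

lemma seidel_eq_tri:
  assumes "i \<le> n"
  shows "int (seidel (2 * n + 1) (int i + 2)) = (\<Sum>j\<le>i. tri j n 0)"
    and "int (seidel (2 * n + 2) (int i + 2)) = tri i (Suc n) 0"
proof -
  \<comment> \<open>Stated for arbitrary \<open>n\<close>, because the induction on odd rows also
    passes through the even rows.\<close>
  have even: "int (seidel (2 * n + 2) (int i + 2)) = tri i (Suc n) 0"
    if i: "i \<le> n" and
      odd: "\<And>i. i \<le> n \<Longrightarrow> int (seidel (2 * n + 1) (int i + 2)) = (\<Sum>j\<le>i. tri j n 0)"
    for n i
  proof -
    have "seidel (2 * n + 2) (int i + 2)
        = (\<Sum>l\<in>{int i + 2..int (Suc n) + 1}. seidel (2 * n + 1) l)"
      using i by simp
    also have "int \<dots> = (\<Sum>l\<in>{i..<Suc n}. int (seidel (2 * n + 1) (int l + 2)))"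
      unfolding sum_int_shift by simp
    also have "\<dots> = (\<Sum>l\<in>{i..<Suc n}. \<Sum>j\<le>l. tri j n 0)"
      by (rule sum.cong) (use odd in \<open>simp_all add: less_Suc_eq_le\<close>)
    finally show ?thesis
      using tri_eq_sum i by simp
  qed
  have odd: "int (seidel (2 * n + 1) (int i + 2)) = (\<Sum>j\<le>i. tri j n 0)" if "i \<le> n" for n i
    using that
  proof (induction n arbitrary: i)
    case 0
    then show ?case by simp
  next
    case (Suc n)
    have row: "int (seidel (2 * n + 2) (int l + 2)) = tri l (Suc n) 0" if "l \<le> Suc n" for l
    proof (cases "l = Suc n")
      \<comment> \<open>Here \<open>k = n + 3\<close> is just past the end of row
        \<open>2 * n + 2\<close>, but row \<open>2 * n + 3\<close> still sums up to it; both sides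
        are 0.\<close>
      case True
      then show ?thesis
        using seidel_eq_0[of "int l + 2" "2 * n + 2"] tri_diagonal[of n 0] by simp
    next
      case False
      then show ?thesis using that Suc.IH by (intro even) auto
    qed
    have "seidel (2 * Suc n + 1) (int i + 2)
        = (\<Sum>l\<in>{int 0 + 2..int (Suc i) + 1}. seidel (2 * n + 2) l)"
      using Suc.prems by (simp del: seidel.simps add: add.commute seidel.simps(3)[of "2 * n + 1", simplified])
    also have "int \<dots> = (\<Sum>l\<in>{0..<Suc i}. int (seidel (2 * n + 2) (int l + 2)))"
      unfolding sum_int_shift by simp
    also have "\<dots> = (\<Sum>l\<in>{0..<Suc i}. tri l (Suc n) 0)"
      by (intro sum.cong refl row) (use Suc.prems in simp)
    finally show ?case
      by (simp add: atLeast0LessThan lessThan_Suc_atMost del: sum.op_ivl_Suc)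
  qed
  show "int (seidel (2 * n + 1) (int i + 2)) = (\<Sum>j\<le>i. tri j n 0)"
    and "int (seidel (2 * n + 2) (int i + 2)) = tri i (Suc n) 0"
    using assms odd even by blast+
qed

theorem theorem4p3:
  fixes n :: nat
  assumes "n \<ge> 1"
  shows "card {p. p permutes {1..2 * n} \<and> collapsed (2 * n) p} = median_genocchi (2 * n - 1)"
proof -
  obtain m where m: "n = Suc m"
    using assms by (cases n) auto
  then have "int (median_genocchi (2 * n - 1)) = tri 0 n 0"
    using seidel_eq_tri(2)[of 0 m] by (simp add: median_genocchi_def)
  then have "int (median_genocchi (2 * n - 1)) = R n 0"
    by simp
  with card_collapsed_even[of n] show ?thesis
    by linarith
qed

end
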